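(* With respect to the Euclidean norm on $\mathbb{R}^2$, $$D_2^*\ge 4\sqrt{2-\sqrt{3}}.$$ In more detail, for every $\varepsilon>0$ there is an $n_0(\varepsilon)$ such that for every integer $n\ge n_0(\varepsilon)$ there exists a grid-like sequence $A_0,A_1,\ldots,A_n\subset\mathbb{R}^2$ such that every transversal $T$ of it satisfies $D(T)> 4\sqrt{2-\sqrt{3}}-\varepsilon$.
   Context: Let $\|\cdot\|$ be the Euclidean norm on $\mathbb{R}^d$ (here $d=2$) and $B_d$ its closed unit ball. A sequence of closed sets $A_0,A_1,\ldots,A_n\subset\mathbb{R}^d$ ($n\ge1$) is called a grid-like sequence if (i) $A_0=\{0\}$ and $A_n=\{s\}$ for some fixed $s\in\mathbb{R}^d$, and (ii) $(a+B_d)\cap A_i\neq\emptyset$ for every $i\in\{1,\ldots,n-1\}$ and every $a\in\mathbb{R}^d$. A transversal of $A_0,\ldots,A_n$ is a selection $T=(a_0,a_1,\ldots,a_n)$ with $a_i\in A_i$ for every $i=0,\ldots,n$. Given a transversal $T$, put $z_i=a_i-a_{i-1}$ for $i\in\{1,\ldots,n\}$ and $$D(T)=D(T,(A_i))=\max_{1\le i,j\le n}\|z_i-z_j\|.$$ Define $D_d^*=\sup_{(A_i)}\min_T D(T,(A_i))$, where the supremum is over all grid-like sequences $(A_i)$ in $\mathbb{R}^d$ (of all lengths $n\ge 1$) and the minimum is over all transversals $T$ of $(A_i)$ (this minimum always exists because the sets $A_i$ are closed). *)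

theory Defs
  imports "HOL-Analysis.Analysis"
begin

text \<open>A sequence \<open>A\<^sub>0, \<dots>, A\<^sub>n\<close> is encoded by its length \<open>n\<close> and a function on \<open>nat\<close>; only the values
  at indices \<open>\<le> n\<close> matter.  The translate \<open>a + B\<^sub>d\<close> of the closed unit ball is \<open>cball a 1\<close>.\<close>

definition grid_like :: "nat \<Rightarrow> (nat \<Rightarrow> (real ^ 'd::finite) set) \<Rightarrow> bool" where
  "grid_like n A \<longleftrightarrow>
     n \<ge> 1 \<and> (\<forall>i\<le>n. closed (A i)) \<and>
     A 0 = {0} \<and> (\<exists>s. A n = {s}) \<and>
     (\<forall>i\<in>{1..<n}. \<forall>a. cball a 1 \<inter> A i \<noteq> {})"

definition transversals :: "nat \<Rightarrow> (nat \<Rightarrow> (real ^ 'd::finite) set) \<Rightarrow> (nat \<Rightarrow> real ^ 'd) set" where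
  "transversals n A = (\<Pi>\<^sub>E i\<in>{0..n}. A i)"

definition increment :: "(nat \<Rightarrow> real ^ 'd::finite) \<Rightarrow> nat \<Rightarrow> real ^ 'd" where
  "increment T i = T i - T (i - 1)"

definition D :: "nat \<Rightarrow> (nat \<Rightarrow> real ^ 'd::finite) \<Rightarrow> real" where
  "D n T = Max ((\<lambda>(i, j). norm (increment T i - increment T j)) ` ({1..n} \<times> {1..n}))"

text \<open>The dimension \<open>d\<close> is \<open>CARD('d)\<close>.  The minimum over transversals is written as an infimum, with
  which it agrees because the minimum is attained.  Values are taken in \<open>ereal\<close> so that the
  supremum is meaningful without a separate boundedness proof.\<close>

definition D_star :: "'d::finite itself \<Rightarrow> ereal" where
  "D_star _ =
     (SUP (n, A) \<in> {(n, A :: nat \<Rightarrow> (real ^ 'd) set). grid_like n A}.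
        INF T \<in> transversals n A. ereal (D n T))"

end

theory Submission
  imports Defs
begin

text \<open>
  Read a transversal as the walk \<open>T 0 = 0, T 1, \<dots>, T n = 0\<close> in the plane; its increments are the steps
  of the walk, and \<open>D n T\<close> is the diameter of the set of steps.  A grid-like sequence may contain
  moving barriers: strips that are removed from the plane, so narrow that every unit ball still meets
  the rest.  Where a strip of width \<open>2\<close> in some norm moves slowly, a walk can get to its other side
  only by a single step of length almost \<open>2\<close> in that norm.

  The extremal picture is the largest equilateral triangle in a square of side \<open>2\<close>.  Its side is
  \<open>2 (\<surd>6 - \<surd>2) = 4 \<surd>(2 - \<surd>3)\<close>; it has one vertex in a corner of the square and one on each of the two
  opposite sides.  So it suffices to build barriers that force the steps to touch all four
  sides of the square \<open>[-1, 1]\<^sup>2\<close> and to reach almost one of its corners, meaning that some step \<open>(a, b)\<close>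
  satisfies \<open>\<bar>a\<bar> + \<bar>b\<bar> \<ge> 2 - \<mu>\<close> with a small \<open>\<mu> > 0\<close> (lemma \<open>triangle_diameter\<close>).  Two kinds of barriers do this.

  \<^item> Fronts.  At time \<open>i\<close> the strips within distance \<open>2\<close> of the lines \<open>y = i\<close> and \<open>y = - i\<close> are removed,
    except for these lines themselves.  The upper front moves at speed \<open>1\<close>; a walk that has no step
    of vertical component \<open>\<le> - 1\<close> can never fall behind it, and is carried away from the origin, to
    which it has to return.  The lower front forces a vertical component \<open>\<ge> 1\<close> in the same way.
    Run backwards in time and applied to \<open>x\<close>, the construction forces the horizontal components.

  \<^item> A gap around a saddle.  The points with \<open>w < \<bar>x\<bar> - \<bar>y\<bar> < w + 2\<close> are removed, where \<open>w\<close> decreases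
    slowly from a positive to a negative value.  The origin begins on the low side of the gap
    and ends on the high side, and \<open>\<bar>x\<bar> - \<bar>y\<bar>\<close> is \<open>1\<close>-Lipschitz for the \<open>\<ell>\<^sub>1\<close> norm, so the walk has to
    make a step of \<open>\<ell>\<^sub>1\<close> norm at least \<open>2 - \<mu>\<close>.

  Barriers of different kinds must not meet, since the union of two removed strips may contain a unit
  ball, and giving one of them priority would let the walk slip through the other.  At time \<open>i\<close> the
  horizontal and the vertical fronts meet at the four points \<open>(\<plusminus>(n - i), \<plusminus>i)\<close>, where \<open>\<bar>x\<bar> + \<bar>y\<bar> = n\<close>.  A
  walk of \<open>n\<close> steps from \<open>0\<close> to \<open>0\<close> whose steps have diameter \<open>\<delta> < 3 / \<surd>2\<close> never gets that far, because
  then \<open>\<bar>x\<bar> + \<bar>y\<bar> \<le> \<surd>2 \<delta> n / 4 < 3 n / 4\<close> (lemma \<open>bridge_bound\<close>).  Hence all barriers may be dropped where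
  \<open>\<bar>x\<bar> + \<bar>y\<bar> \<ge> 3 n / 4\<close>.  A walk that has only steps of \<open>\<ell>\<^sub>1\<close> norm less than \<open>2\<close> even stays within
  \<open>\<bar>x\<bar> + \<bar>y\<bar> < min (2 i) (2 (n - i))\<close>, so the gap may be dropped outside of that range; for small \<open>\<mu>\<close>
  this separates it from the fronts.
\<close>

section \<open>The barriers\<close>

text \<open>The coordinate \<open>u\<close> is neither strictly between \<open>t - 2\<close> and \<open>t\<close> nor strictly between \<open>t\<close> and
  \<open>t + 2\<close> in absolute value.  With \<open>\<bar>u\<bar>\<close> in place of \<open>u\<close>, one condition describes two fronts that move
  in opposite directions, also while they overlap at times near \<open>0\<close>.\<close>
definition front :: "real \<Rightarrow> real \<Rightarrow> bool" where
  "front t u \<longleftrightarrow> \<bar>u\<bar> = t \<or> \<bar>u\<bar> \<le> t - 2 \<or> t + 2 \<le> \<bar>u\<bar>"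

text \<open>The lower end of the gap, as a value of \<open>\<bar>x\<bar> - \<bar>y\<bar>\<close>; it moves at speed \<open>\<mu>\<close> and is centred so that it
  passes \<open>0\<close> at half time.\<close>
definition level :: "real \<Rightarrow> nat \<Rightarrow> nat \<Rightarrow> real" where
  "level \<mu> n i = \<mu> * (real n / 2 - real i)"

text \<open>The first two alternatives switch the gap off where walks with steps of \<open>\<ell>\<^sub>1\<close> norm less than \<open>2\<close>
  cannot be at time \<open>i\<close>.\<close>
definition avoids_gap :: "real \<Rightarrow> nat \<Rightarrow> nat \<Rightarrow> real \<Rightarrow> real \<Rightarrow> bool" where
  "avoids_gap \<mu> n i x y \<longleftrightarrow>
     2 * real i \<le> \<bar>x\<bar> + \<bar>y\<bar> \<or> 2 * (real n - real i) \<le> \<bar>x\<bar> + \<bar>y\<bar> \<or>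
     \<bar>x\<bar> - \<bar>y\<bar> \<le> level \<mu> n i \<or> level \<mu> n i + 2 \<le> \<bar>x\<bar> - \<bar>y\<bar>"

definition admissible :: "real \<Rightarrow> nat \<Rightarrow> nat \<Rightarrow> real \<Rightarrow> real \<Rightarrow> bool" where
  "admissible \<mu> n i x y \<longleftrightarrow>
     3 * real n / 4 \<le> \<bar>x\<bar> + \<bar>y\<bar> \<or>
     (front (real i) y \<and> front (real n - real i) x \<and> avoids_gap \<mu> n i x y)"

definition barriers :: "real \<Rightarrow> nat \<Rightarrow> nat \<Rightarrow> (real ^ 2) set" where
  "barriers \<mu> n i = (if i = 0 \<or> i = n then {0} else {a. admissible \<mu> n i (a $ 1) (a $ 2)})"

section \<open>Every unit ball meets the sets between the barriers\<close>

text \<open>The forbidden values of \<open>\<bar>u\<bar>\<close> form two intervals of length \<open>2\<close>, so an endpoint is always within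
  distance \<open>1\<close>.  The lower bound on \<open>\<bar>u + e\<bar>\<close> records that the point stays close to the front and therefore
  away from the other barriers.\<close>
lemma front_near:
  assumes "\<not> front (real k) u"
  obtains e where "\<bar>e\<bar> \<le> 1" "front (real k) (u + e)" "real k - 2 \<le> \<bar>u + e\<bar>"
proof -
  have near: "real k - 2 < \<bar>u\<bar>" "\<bar>u\<bar> < real k + 2"
    using assms by (auto simp: front_def)
  define w where
    "w = (if real k + 1 \<le> \<bar>u\<bar> then real k + 2 else if real k - 1 \<le> \<bar>u\<bar> then real k else real k - 2)"
  \<comment> \<open>The value \<open>k - 2\<close> is chosen only when \<open>\<bar>u\<bar> < k - 1\<close>; then \<open>k > 1\<close>, and \<open>k \<ge> 2\<close> because
    \<open>k\<close> is an integer, so it is a possible absolute value.\<close>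
  have "2 \<le> real k" if "\<bar>u\<bar> < real k - 1"
  proof -
    have "1 < real k" using that by linarith
    then have "2 \<le> k" by linarith
    then show ?thesis by simp
  qed
  then have w: "0 \<le> w" "real k - 2 \<le> w" "\<bar>w - \<bar>u\<bar>\<bar> \<le> 1"
      "w = real k \<or> w = real k - 2 \<or> w = real k + 2"
    using near unfolding w_def by auto
  define e where "e = (if 0 \<le> u then w - u else - w - u)"
  have e: "\<bar>u + e\<bar> = w" using w(1) by (simp add: e_def)
  have "\<bar>e\<bar> \<le> 1" using w(3) by (auto simp: e_def abs_le_iff)
  moreover have "front (real k) (u + e)" unfolding front_def e using w(4) by linarith
  ultimately show ?thesis using that[of e] w(2) e by simp
qed

text \<open>Near both fronts \<open>\<bar>x\<bar> + \<bar>y\<bar>\<close> would be at least \<open>n - 4\<close>.  The lemma is also used with the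
  coordinates exchanged and \<open>n - i\<close> for \<open>i\<close>.\<close>
lemma fronts_disjoint:
  assumes "16 \<le> n" "real i - 2 \<le> \<bar>y\<bar>" "\<bar>x\<bar> + \<bar>y\<bar> < 3 * real n / 4"
  shows "front (real n - real i) x"
  using assms unfolding front_def by linarith

text \<open>On the high side of the lower end of the gap, \<open>\<bar>x\<bar> + \<bar>y\<bar> \<ge> 2 \<bar>y\<bar> + w\<close>.  Near the horizontal front this
  is at least \<open>2 i - 4 + w\<close>.  While \<open>w \<ge> 5\<close> this exceeds the range \<open>2 i + 1\<close> in question; once \<open>w < 5\<close>,
  half of the time has almost passed, and then \<open>2 i - 4 + w\<close> is close to \<open>n\<close> or larger, since \<open>w\<close>
  decreases at speed \<open>\<mu> \<le> 1\<close> only.  The constants leave room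
  for a displacement by \<open>1\<close>.\<close>
lemma gap_misses_horizontal_front:
  assumes "0 < \<mu>" "\<mu> \<le> 1" "16 + 40 / \<mu> \<le> real n"
    and "\<bar>x\<bar> + \<bar>y\<bar> < 3 * real n / 4" "\<bar>x\<bar> + \<bar>y\<bar> < 2 * real i + 1"
    and "level \<mu> n i \<le> \<bar>x\<bar> - \<bar>y\<bar>"
  shows "\<bar>y\<bar> < real i - 2"
proof (rule ccontr)
  assume "\<not> \<bar>y\<bar> < real i - 2"
  define k where "k = real n / 2 - real i"
  have l: "level \<mu> n i = \<mu> * k" by (simp add: level_def k_def)
  have N: "2 * real i - 4 + \<mu> * k \<le> \<bar>x\<bar> + \<bar>y\<bar>"
    using \<open>\<not> _\<close> assms(6) l by linarith
  with assms(5) have mk: "\<mu> * k < 5" by linarith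
  have "(2 - \<mu>) * k \<le> 10 / \<mu>"
  proof (cases "k \<le> 0")
    case True
    have "(2 - \<mu>) * k \<le> 0" using True assms(2) by (simp add: mult_nonneg_nonpos)
    also have "0 \<le> 10 / \<mu>" using assms(1) by simp
    finally show ?thesis .
  next
    case False
    have "(2 - \<mu>) * k \<le> 2 * k" using False assms(1) by (simp add: mult_right_mono)
    also have "\<dots> \<le> 10 / \<mu>" using mk assms(1) by (simp add: field_simps)
    finally show ?thesis .
  qed
  moreover have "2 * real i - 4 + \<mu> * k = real n - 4 - (2 - \<mu>) * k"
    by (simp add: k_def field_simps)
  moreover have "40 / \<mu> = 4 * (10 / \<mu>)" by simp
  ultimately show False using N assms(3,4) by linarith
qed

text \<open>The counterpart under the symmetry that reverses time and exchanges the coordinates.  That symmetry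
  turns the gap from \<open>w\<close> to \<open>w + 2\<close> into one from \<open>w - 2\<close> to \<open>w\<close>, which is why the constants differ.\<close>
lemma gap_misses_vertical_front:
  assumes "0 < \<mu>" "\<mu> \<le> 1" "24 + 56 / \<mu> \<le> real n"
    and "\<bar>x\<bar> + \<bar>y\<bar> < 3 * real n / 4" "\<bar>x\<bar> + \<bar>y\<bar> < 2 * (real n - real i) + 1"
    and "\<bar>x\<bar> - \<bar>y\<bar> \<le> level \<mu> n i + 2"
  shows "\<bar>x\<bar> < real n - real i - 2"
proof (rule ccontr)
  assume "\<not> \<bar>x\<bar> < real n - real i - 2"
  define k where "k = real i - real n / 2"
  have l: "level \<mu> n i = - (\<mu> * k)" by (simp add: level_def k_def algebra_simps)
  have "real n - real i - 2 \<le> \<bar>x\<bar>" using \<open>\<not> _\<close> by simp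
  moreover have "\<bar>x\<bar> - \<bar>y\<bar> \<le> 2 - \<mu> * k" using assms(6) l by simp
  ultimately have N: "2 * (real n - real i) - 6 + \<mu> * k \<le> \<bar>x\<bar> + \<bar>y\<bar>"
    by simp
  with assms(5) have mk: "\<mu> * k < 7" by linarith
  have "(2 - \<mu>) * k \<le> 14 / \<mu>"
  proof (cases "k \<le> 0")
    case True
    have "(2 - \<mu>) * k \<le> 0" using True assms(2) by (simp add: mult_nonneg_nonpos)
    also have "0 \<le> 14 / \<mu>" using assms(1) by simp
    finally show ?thesis .
  next
    case False
    have "(2 - \<mu>) * k \<le> 2 * k" using False assms(1) by (simp add: mult_right_mono)
    also have "\<dots> \<le> 14 / \<mu>" using mk assms(1) by (simp add: field_simps)
    finally show ?thesis .
  qed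
  moreover have "2 * (real n - real i) - 6 + \<mu> * k = real n - 6 - (2 - \<mu>) * k"
    by (simp add: k_def field_simps)
  moreover have "56 / \<mu> = 4 * (14 / \<mu>)" by simp
  ultimately show False using N assms(3,4) by linarith
qed

text \<open>If a barrier forbids a point, moving one coordinate by at most \<open>1\<close> leads to the edge of that
  barrier, and no other barrier is in force there because the barriers are disjoint.  For the gap,
  the two directions differ: \<open>\<bar>x\<bar> - \<bar>y\<bar>\<close> can always be increased by moving away from the \<open>y\<close>-axis and
  decreased by moving away from the \<open>x\<close>-axis, so that the saddle at the origin is no exception.\<close>
lemma admissible_near:
  assumes mu: "0 < \<mu>" "\<mu> \<le> 1" and n: "24 + 56 / \<mu> \<le> real n" and i: "i \<le> n"
  obtains e where "\<bar>e\<bar> \<le> 1" "admissible \<mu> n i (x + e) y \<or> admissible \<mu> n i x (y + e)"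
proof -
  have n': "16 + 40 / \<mu> \<le> real n" "16 \<le> n"
  proof -
    have "40 / \<mu> \<le> 56 / \<mu>" using mu by (simp add: divide_right_mono)
    moreover have "0 \<le> 40 / \<mu>" using mu by simp
    ultimately show "16 + 40 / \<mu> \<le> real n" "16 \<le> n" using n by linarith+
  qed
  consider (y) "\<not> front (real i) y" | (x) "\<not> front (real n - real i) x"
    | (gap) "front (real i) y" "front (real n - real i) x" "\<not> avoids_gap \<mu> n i x y"
      "\<bar>x\<bar> + \<bar>y\<bar> < 3 * real n / 4"
    | (adm) "admissible \<mu> n i x y"
    unfolding admissible_def by linarith
  then show ?thesis
  proof cases
    case adm
    then show ?thesis using that[of 0] by simp
  next
    case y
    obtain e where e: "\<bar>e\<bar> \<le> 1" "front (real i) (y + e)" "real i - 2 \<le> \<bar>y + e\<bar>"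
      using front_near[OF y] by blast
    have "admissible \<mu> n i x (y + e)"
    proof (rule ccontr)
      assume na: "\<not> ?thesis"
      then have N: "\<bar>x\<bar> + \<bar>y + e\<bar> < 3 * real n / 4" by (auto simp: admissible_def)
      from fronts_disjoint[OF n'(2) e(3) N] have "front (real n - real i) x" .
      with na e(2) have "\<not> avoids_gap \<mu> n i x (y + e)" by (auto simp: admissible_def)
      then have "\<bar>y + e\<bar> < real i - 2"
        using gap_misses_horizontal_front[OF mu n'(1) N, of i] unfolding avoids_gap_def by linarith
      with e(3) show False by linarith
    qed
    with e(1) show ?thesis using that[of e] by auto
  next
    case x
    obtain e where e: "\<bar>e\<bar> \<le> 1" "front (real n - real i) (x + e)"
        "real n - real i - 2 \<le> \<bar>x + e\<bar>"
      using front_near[of "n - i" x] x i by (auto simp: of_nat_diff)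
    have "admissible \<mu> n i (x + e) y"
    proof (rule ccontr)
      assume na: "\<not> ?thesis"
      then have N: "\<bar>x + e\<bar> + \<bar>y\<bar> < 3 * real n / 4" by (auto simp: admissible_def)
      have "front (real i) y"
        using fronts_disjoint[OF n'(2), of "n - i" "x + e" y] e(3) N i by (simp add: of_nat_diff)
      with na e(2) have "\<not> avoids_gap \<mu> n i (x + e) y" by (auto simp: admissible_def)
      then have "\<bar>x + e\<bar> < real n - real i - 2"
        using gap_misses_vertical_front[OF mu n N, of i] unfolding avoids_gap_def by linarith
      with e(3) show False by linarith
    qed
    with e(1) show ?thesis using that[of e] by auto
  next
    case gap
    define \<psi> where "\<psi> = \<bar>x\<bar> - \<bar>y\<bar>"
    have g: "level \<mu> n i < \<psi>" "\<psi> < level \<mu> n i + 2"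
        "\<bar>x\<bar> + \<bar>y\<bar> < 2 * real i" "\<bar>x\<bar> + \<bar>y\<bar> < 2 * (real n - real i)"
      using gap(3) by (auto simp: avoids_gap_def \<psi>_def)
    \<comment> \<open>An end of the gap, reached by a move of length at most \<open>1\<close>, is far from both fronts.\<close>
    have stay: "admissible \<mu> n i x' y'"
      if "\<bar>x'\<bar> + \<bar>y'\<bar> \<le> \<bar>x\<bar> + \<bar>y\<bar> + 1"
        "\<bar>x'\<bar> - \<bar>y'\<bar> = level \<mu> n i \<or> \<bar>x'\<bar> - \<bar>y'\<bar> = level \<mu> n i + 2" for x' y'
    proof (cases "3 * real n / 4 \<le> \<bar>x'\<bar> + \<bar>y'\<bar>")
      case True
      then show ?thesis by (simp add: admissible_def)
    next
      case False
      then have N: "\<bar>x'\<bar> + \<bar>y'\<bar> < 3 * real n / 4" by simp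
      have "\<bar>y'\<bar> < real i - 2"
        using gap_misses_horizontal_front[OF mu n'(1) N, of i] that g by linarith
      moreover have "\<bar>x'\<bar> < real n - real i - 2"
        using gap_misses_vertical_front[OF mu n N, of i] that g by linarith
      moreover have "avoids_gap \<mu> n i x' y'" using that(2) by (auto simp: avoids_gap_def)
      ultimately show ?thesis by (simp add: admissible_def front_def)
    qed
    show ?thesis
    proof (cases "level \<mu> n i + 1 \<le> \<psi>")
      case True
      define d where "d = level \<mu> n i + 2 - \<psi>"
      have d: "0 < d" "d \<le> 1" using g True by (auto simp: d_def)
      define e where "e = (if 0 \<le> x then d else - d)"
      have "\<bar>x + e\<bar> = \<bar>x\<bar> + d" "\<bar>e\<bar> \<le> 1" using d by (auto simp: e_def)
      with stay[of "x + e" y] d show ?thesis using that[of e] by (auto simp: d_def \<psi>_def)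
    next
      case False
      define d where "d = \<psi> - level \<mu> n i"
      have d: "0 < d" "d \<le> 1" using g False by (auto simp: d_def)
      define e where "e = (if 0 \<le> y then d else - d)"
      have "\<bar>y + e\<bar> = \<bar>y\<bar> + d" "\<bar>e\<bar> \<le> 1" using d by (auto simp: e_def)
      with stay[of x "y + e"] d show ?thesis using that[of e] by (auto simp: d_def \<psi>_def)
    qed
  qed
qed

lemma closed_admissible: "closed {a :: real ^ 2. admissible \<mu> n i (a $ 1) (a $ 2)}"
  unfolding admissible_def avoids_gap_def front_def
  by (intro closed_Collect_disj closed_Collect_conj closed_Collect_le closed_Collect_eq
      continuous_intros)

lemma norm_vec2: "norm (v :: real ^ 2) = sqrt ((v $ 1)\<^sup>2 + (v $ 2)\<^sup>2)"
  by (simp add: norm_vec_def L2_set_def sum_2)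

lemma grid_like_barriers:
  assumes mu: "0 < \<mu>" "\<mu> \<le> 1" and n: "24 + 56 / \<mu> \<le> real n"
  shows "grid_like n (barriers \<mu> n)"
proof -
  have "0 < 56 / \<mu>" using mu by simp
  then have "1 \<le> n" using n by linarith
  moreover have "closed (barriers \<mu> n i)" for i
    using closed_admissible by (simp add: barriers_def)
  moreover have "cball a 1 \<inter> barriers \<mu> n i \<noteq> {}" if i: "i \<in> {1..<n}" for i and a :: "real ^ 2"
  proof -
    have B: "barriers \<mu> n i = {a. admissible \<mu> n i (a $ 1) (a $ 2)}"
      using i by (simp add: barriers_def)
    obtain e where e: "\<bar>e\<bar> \<le> 1"
        "admissible \<mu> n i (a $ 1 + e) (a $ 2) \<or> admissible \<mu> n i (a $ 1) (a $ 2 + e)"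
      using admissible_near[OF mu n, of i "a $ 1" "a $ 2"] i by auto
    then consider "a + axis 1 e \<in> barriers \<mu> n i" | "a + axis 2 e \<in> barriers \<mu> n i"
      unfolding B by (auto simp: axis_def)
    then show ?thesis
    proof cases
      case 1
      then have "a + axis 1 e \<in> cball a 1 \<inter> barriers \<mu> n i"
        using e(1) by (simp add: dist_norm norm_vec2 axis_def)
      then show ?thesis by blast
    next
      case 2
      then have "a + axis 2 e \<in> cball a 1 \<inter> barriers \<mu> n i"
        using e(1) by (simp add: dist_norm norm_vec2 axis_def)
      then show ?thesis by blast
    qed
  qed
  ultimately show ?thesis by (auto simp: grid_like_def barriers_def)
qed

section \<open>What the barriers force\<close>

text \<open>Comparing each of the first \<open>t\<close> increments with each of the remaining ones gives
  \<open>n f(t) \<le> t (n - t) \<Delta> \<le> n\<^sup>2 \<Delta> / 4\<close>.\<close>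
lemma bridge_bound:
  fixes f :: "nat \<Rightarrow> real"
  assumes "0 < n" "f 0 = 0" "f n = 0" "t \<le> n" "0 \<le> \<Delta>"
    and diff: "\<And>i j. i < n \<Longrightarrow> j < n \<Longrightarrow> (f (Suc i) - f i) - (f (Suc j) - f j) \<le> \<Delta>"
  shows "f t \<le> \<Delta> * real n / 4"
proof -
  define g where "g i = f (Suc i) - f i" for i
  have s1: "(\<Sum>i<t. g i) = f t"
    using sum_lessThan_telescope[of f t] assms(2) by (simp add: g_def)
  have s2: "(\<Sum>j=t..<n. g j) = - f t"
    using sum_Suc_diff'[of t n f] assms by (simp add: g_def)
  have "real n * f t = (\<Sum>i<t. \<Sum>j=t..<n. g i - g j)"
  proof -
    have "(\<Sum>i<t. \<Sum>j=t..<n. g i - g j) = (real n - real t) * (\<Sum>i<t. g i) - real t * (\<Sum>j=t..<n. g j)"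
      using assms(4) by (simp add: sum_subtractf sum_distrib_left of_nat_diff)
    then show ?thesis by (simp add: s1 s2 algebra_simps)
  qed
  also have "\<dots> \<le> (\<Sum>i<t. \<Sum>j=t..<n. \<Delta>)"
    using diff by (intro sum_mono) (auto simp: g_def)
  also have "\<dots> = \<Delta> * (real t * (real n - real t))"
    using assms(4) by (simp add: of_nat_diff)
  also have "\<dots> \<le> \<Delta> * ((real n)\<^sup>2 / 4)"
  proof (rule mult_left_mono[OF _ assms(5)])
    have "0 \<le> (real n - 2 * real t)\<^sup>2" by simp
    then show "real t * (real n - real t) \<le> (real n)\<^sup>2 / 4"
      by (simp add: power2_eq_square algebra_simps)
  qed
  finally have "real n * f t \<le> real n * (\<Delta> * real n / 4)"
    by (simp add: power2_eq_square algebra_simps)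
  then show ?thesis using assms(1) by simp
qed

text \<open>The invariant is that the walk is on the front or at least \<open>2\<close> ahead of it: in one time unit its
  distance to the front drops by less than \<open>2\<close>, so it cannot jump over the removed strip, and a
  position on the front persists only by moving along with it.\<close>
lemma front_crossing:
  fixes f :: "nat \<Rightarrow> real"
  assumes "2 \<le> n" "f 0 = 0" "f n = 0"
    and fr: "\<And>i. 0 < i \<Longrightarrow> i < n \<Longrightarrow> front (real i) (f i)"
  shows "\<exists>i<n. f (Suc i) - f i \<le> - 1"
proof (rule ccontr)
  assume "\<not> ?thesis"
  then have st: "f (Suc i) - f i > - 1" if "i < n" for i using that by force
  have ahead: "f i = real i \<or> real i + 2 \<le> f i" if "i < n" for i
    using that
  proof (induction i)
    case 0
    then show ?case using assms by simp
  next
    case (Suc i)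
    then have "f i = real i \<or> real i + 2 \<le> f i" "f (Suc i) - f i > - 1" "front (real (Suc i)) (f (Suc i))"
      using st[of i] fr[of "Suc i"] by simp_all
    then show ?case unfolding front_def of_nat_Suc by linarith
  qed
  have "f (Suc (n - 1)) - f (n - 1) > - 1" "f (n - 1) = real (n - 1) \<or> real (n - 1) + 2 \<le> f (n - 1)"
    using st[of "n - 1"] ahead[of "n - 1"] assms(1) by auto
  moreover have "Suc (n - 1) = n" "real (n - 1) = real n - 1" "2 \<le> real n" using assms(1) by auto
  ultimately show False using assms(3) by simp
qed

text \<open>With shorter steps the walk stays where the gap is in force, and in each time unit \<open>\<bar>x\<bar> - \<bar>y\<bar>\<close>
  increases by less than \<open>2\<close> relative to the gap, which moves down by \<open>\<mu>\<close>.  So the walk never leaves the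
  low side, whereas at time \<open>n\<close> the origin is on the high side.\<close>
lemma gap_crossing:
  fixes x y :: "nat \<Rightarrow> real"
  assumes mu: "0 < \<mu>" "\<mu> \<le> 1" and n: "4 / \<mu> \<le> real n" "0 < n"
    and "x 0 = 0" "y 0 = 0" "x n = 0" "y n = 0"
    and av: "\<And>i. 0 < i \<Longrightarrow> i < n \<Longrightarrow> avoids_gap \<mu> n i (x i) (y i)"
  shows "\<exists>i<n. 2 - \<mu> \<le> \<bar>x (Suc i) - x i\<bar> + \<bar>y (Suc i) - y i\<bar>"
proof (rule ccontr)
  assume "\<not> ?thesis"
  then have st: "\<bar>x (Suc i) - x i\<bar> + \<bar>y (Suc i) - y i\<bar> < 2 - \<mu>" if "i < n" for i
    using that by force
  have fwd: "\<bar>x i\<bar> + \<bar>y i\<bar> \<le> (2 - \<mu>) * real i" if "i \<le> n" for i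
    using that
  proof (induction i)
    case 0
    then show ?case using assms by simp
  next
    case (Suc i)
    then have "\<bar>x i\<bar> + \<bar>y i\<bar> \<le> (2 - \<mu>) * real i" by simp
    moreover have "(2 - \<mu>) * real (Suc i) = (2 - \<mu>) * real i + (2 - \<mu>)" by (simp add: algebra_simps)
    ultimately show ?case using st[of i] Suc.prems by linarith
  qed
  have bwd: "\<bar>x (n - i)\<bar> + \<bar>y (n - i)\<bar> \<le> (2 - \<mu>) * real i" if "i \<le> n" for i
    using that
  proof (induction i)
    case 0
    then show ?case using assms by simp
  next
    case (Suc i)
    then have "\<bar>x (n - i)\<bar> + \<bar>y (n - i)\<bar> \<le> (2 - \<mu>) * real i" by simp
    moreover have "(2 - \<mu>) * real (Suc i) = (2 - \<mu>) * real i + (2 - \<mu>)" by (simp add: algebra_simps)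
    moreover have "Suc (n - Suc i) = n - i" using Suc.prems by simp
    moreover have "\<bar>x (n - i) - x (n - Suc i)\<bar> + \<bar>y (n - i) - y (n - Suc i)\<bar> < 2 - \<mu>"
      using st[of "n - Suc i"] Suc.prems calculation(3) by simp
    ultimately show ?case by linarith
  qed
  have lt: "(2 - \<mu>) * real i < 2 * real i" if "0 < i" for i using that mu by simp
  have lev: "level \<mu> n (Suc i) = level \<mu> n i - \<mu>" for i by (simp add: level_def algebra_simps)
  have below: "\<bar>x i\<bar> - \<bar>y i\<bar> \<le> level \<mu> n i" if "i < n" for i
    using that
  proof (induction i)
    case 0
    then show ?case using assms by (simp add: level_def)
  next
    case (Suc i)
    have "\<bar>x (Suc i)\<bar> - \<bar>y (Suc i)\<bar> < level \<mu> n (Suc i) + 2"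
      using Suc st[of i] lev[of i] by linarith
    moreover have "\<bar>x (Suc i)\<bar> + \<bar>y (Suc i)\<bar> < 2 * real (Suc i)"
      using fwd[of "Suc i"] lt[of "Suc i"] Suc.prems by linarith
    moreover have "\<bar>x (Suc i)\<bar> + \<bar>y (Suc i)\<bar> < 2 * (real n - real (Suc i))"
      using bwd[of "n - Suc i"] lt[of "n - Suc i"] Suc.prems by (simp add: of_nat_diff)
    ultimately show ?case using av[of "Suc i"] Suc.prems unfolding avoids_gap_def by linarith
  qed
  have "Suc (n - 1) = n" using n(2) by simp
  then have "0 < level \<mu> n n + 2"
    using below[of "n - 1"] st[of "n - 1"] lev[of "n - 1"] assms(7,8) n(2) by simp linarith
  moreover have "level \<mu> n n = - (\<mu> * real n / 2)" by (simp add: level_def algebra_simps)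
  moreover have "4 \<le> \<mu> * real n" using n(1) mu by (simp add: field_simps)
  ultimately show False by linarith
qed

section \<open>The extremal triangle\<close>

lemma inner_le_of_norm:
  fixes v :: "real ^ 2"
  assumes "norm v \<le> \<delta>"
  shows "a * v $ 1 + b * v $ 2 \<le> sqrt (a\<^sup>2 + b\<^sup>2) * \<delta>"
proof -
  have "a * v $ 1 + b * v $ 2 = (vector [a, b] :: real ^ 2) \<bullet> v"
    by (simp add: inner_vec_def sum_2)
  also have "\<dots> \<le> norm (vector [a, b] :: real ^ 2) * norm v" by (rule norm_cauchy_schwarz)
  also have "\<dots> \<le> sqrt (a\<^sup>2 + b\<^sup>2) * \<delta>"
    using assms by (simp add: norm_vec2 mult_left_mono)
  finally show ?thesis .
qed

text \<open>The second bound says that \<open>3 / \<surd>2\<close>, below which walks stay away from the meeting points of the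
  fronts, exceeds the value to be proved.\<close>
lemma extremal_value_bounds:
  "sqrt 3 \<le> (2 :: real)"
  "sqrt 2 * (4 * sqrt (2 - sqrt 3)) < (3 :: real)" "4 * sqrt (2 - sqrt 3) < (3 :: real)"
proof -
  show le: "sqrt 3 \<le> (2 :: real)" by (rule real_le_lsqrt) auto
  have lt: "sqrt 3 < (2 :: real)" by (rule real_less_lsqrt) auto
  then have pos: "0 < 4 * sqrt (2 - sqrt (3 :: real))" by simp
  have "55 / 32 < sqrt (3 :: real)" by (rule real_less_rsqrt) (simp add: power2_eq_square)
  then have "(sqrt 2 * (4 * sqrt (2 - sqrt 3)))\<^sup>2 < (3 :: real)\<^sup>2"
    using le by (simp add: power_mult_distrib)
  then show 3: "sqrt 2 * (4 * sqrt (2 - sqrt 3)) < (3 :: real)" by (rule power2_less_imp_less) simp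
  have "1 * (4 * sqrt (2 - sqrt 3)) \<le> sqrt 2 * (4 * sqrt (2 - sqrt (3 :: real)))"
    using pos by (intro mult_right_mono) auto
  with 3 show "4 * sqrt (2 - sqrt 3) < (3 :: real)" by linarith
qed

text \<open>The smallest triangle with vertices \<open>p\<close>, \<open>q\<close>, \<open>r\<close> in the three given half-planes is, for \<open>\<mu> = 0\<close>, the
  equilateral triangle inscribed in the square with a vertex at the corner.  The proof bounds each
  side from below by its projection to the direction of the corresponding side of that triangle.
  For the corner \<open>(1, 1)\<close> the directions are \<open>(a, b)\<close>, \<open>(b, a)\<close>, proportional to \<open>(cos 15\<degree>, sin 15\<degree>)\<close> and its mirror image, and
  \<open>(-1, 1)\<close> with weight \<open>b\<close>; with these weights only the three quantities bounded by the hypotheses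
  remain in the sum.  The signs \<open>\<sigma>\<close>, \<open>\<tau>\<close> say which corner of the square \<open>p\<close> is near.\<close>
lemma triangle_diameter:
  fixes p q r :: "real ^ 2"
  assumes sg: "\<bar>\<sigma>\<bar> = 1" "\<bar>\<tau>\<bar> = 1"
    and p: "2 - \<mu> \<le> \<sigma> * p $ 1 + \<tau> * p $ 2" and q: "\<sigma> * q $ 1 \<le> - 1" and r: "\<tau> * r $ 2 \<le> - 1"
    and d: "norm (p - q) \<le> \<delta>" "norm (p - r) \<le> \<delta>" "norm (q - r) \<le> \<delta>"
  shows "(1 - \<mu> / 4) * (4 * sqrt (2 - sqrt 3)) \<le> \<delta>"
proof -
  define a b :: real where "a = sqrt 3 + 1" and "b = sqrt 3 - 1"
  have s2: "\<sigma>\<^sup>2 = 1" "\<tau>\<^sup>2 = 1" using sg by (metis power2_abs one_power2)+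
  have b0: "0 \<le> b" by (simp add: b_def)
  have ab: "a\<^sup>2 + b\<^sup>2 = 8" by (simp add: a_def b_def power2_eq_square algebra_simps)
  have r8: "sqrt 8 = 2 * sqrt 2"
    using real_sqrt_mult[of 4 2] by simp
  have 1: "\<sigma> * a * (p - q) $ 1 + \<tau> * b * (p - q) $ 2 \<le> 2 * sqrt 2 * \<delta>"
    using inner_le_of_norm[OF d(1), of "\<sigma> * a" "\<tau> * b"] s2 ab r8 by (simp add: power_mult_distrib)
  have 2: "\<sigma> * b * (p - r) $ 1 + \<tau> * a * (p - r) $ 2 \<le> 2 * sqrt 2 * \<delta>"
    using inner_le_of_norm[OF d(2), of "\<sigma> * b" "\<tau> * a"] s2 ab r8
    by (simp add: power_mult_distrib add.commute)
  have "- \<sigma> * (q - r) $ 1 + \<tau> * (q - r) $ 2 \<le> sqrt 2 * \<delta>"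
    using inner_le_of_norm[OF d(3), of "- \<sigma>" "\<tau>"] s2 by simp
  from mult_left_mono[OF this b0]
  have 3: "b * (- \<sigma> * (q - r) $ 1 + \<tau> * (q - r) $ 2) \<le> b * (sqrt 2 * \<delta>)" .
  have pqr: "4 - \<mu> \<le> \<sigma> * p $ 1 + \<tau> * p $ 2 - \<sigma> * q $ 1 - \<tau> * r $ 2"
    using p q r by linarith
  have "(a + b) * (4 - \<mu>) \<le> (a + b) * (\<sigma> * p $ 1 + \<tau> * p $ 2 - \<sigma> * q $ 1 - \<tau> * r $ 2)"
    by (rule mult_left_mono[OF pqr]) (simp add: a_def b_def)
  also have "\<dots> = (\<sigma> * a * (p - q) $ 1 + \<tau> * b * (p - q) $ 2)
      + (\<sigma> * b * (p - r) $ 1 + \<tau> * a * (p - r) $ 2)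
      + b * (- \<sigma> * (q - r) $ 1 + \<tau> * (q - r) $ 2)"
    by (simp add: algebra_simps)
  also have "\<dots> \<le> 2 * sqrt 2 * \<delta> + 2 * sqrt 2 * \<delta> + b * (sqrt 2 * \<delta>)"
    using 1 2 3 by linarith
  also have "\<dots> = (4 + b) * sqrt 2 * \<delta>" by (simp add: algebra_simps)
  also have "4 + b = sqrt 3 * a" by (simp add: a_def b_def algebra_simps)
  finally have "sqrt 3 * (2 * (4 - \<mu>)) \<le> sqrt 3 * (a * sqrt 2 * \<delta>)"
    by (simp add: a_def b_def algebra_simps)
  then have main: "2 * (4 - \<mu>) \<le> a * sqrt 2 * \<delta>" by simp
  define \<delta>' where "\<delta>' = 4 * sqrt (2 - sqrt 3)"
  have "(a * sqrt 2 * \<delta>')\<^sup>2 = 32 * ((sqrt 3 + 1)\<^sup>2 * (2 - sqrt 3))"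
    using extremal_value_bounds(1) by (simp add: a_def \<delta>'_def power_mult_distrib)
  also have "\<dots> = 8\<^sup>2" by (simp add: power2_eq_square algebra_simps)
  finally have "a * sqrt 2 * \<delta>' = 8"
    by (rule power2_eq_imp_eq) (use extremal_value_bounds(1) in \<open>auto simp: a_def \<delta>'_def\<close>)
  moreover have "a * sqrt 2 * ((1 - \<mu> / 4) * \<delta>') = (1 - \<mu> / 4) * (a * sqrt 2 * \<delta>')"
    by (simp only: mult.left_commute)
  ultimately have "a * sqrt 2 * ((1 - \<mu> / 4) * \<delta>') = 2 * (4 - \<mu>)"
    by (simp add: algebra_simps)
  with main have "a * sqrt 2 * ((1 - \<mu> / 4) * \<delta>') \<le> a * sqrt 2 * \<delta>" by simp
  moreover have "0 < a * sqrt 2" by (simp add: a_def add_pos_pos)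
  ultimately have "(1 - \<mu> / 4) * \<delta>' \<le> \<delta>" by (simp add: mult_le_cancel_left_pos)
  then show ?thesis by (simp add: \<delta>'_def)
qed

section \<open>The lower bound\<close>

text \<open>If the steps have diameter at least \<open>3 / \<surd>2\<close>, the bound is immediate.  Otherwise the walk
  stays where the fronts are in force, and the forced steps form the triangle.\<close>
lemma diameter_of_barrier_transversal:
  assumes mu: "0 < \<mu>" "\<mu> \<le> 1" and n: "24 + 56 / \<mu> \<le> real n"
    and T: "T \<in> transversals n (barriers \<mu> n)"
  shows "(1 - \<mu> / 4) * (4 * sqrt (2 - sqrt 3)) \<le> D n T"
proof -
  define \<delta> where "\<delta> = D n T"
  define z where "z i = T (Suc i) - T i" for i
  have "0 < 56 / \<mu>" "4 / \<mu> \<le> 56 / \<mu>" using mu by (auto simp: divide_right_mono)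
  then have n': "24 \<le> n" "4 / \<mu> \<le> real n" using n by linarith+
  have diam: "norm (z i - z j) \<le> \<delta>" if "i < n" "j < n" for i j
    unfolding \<delta>_def D_def
  proof (rule Max_ge)
    show "norm (z i - z j) \<in> (\<lambda>(i, j). norm (increment T i - increment T j)) ` ({1..n} \<times> {1..n})"
      using that by (intro image_eqI[of _ _ "(Suc i, Suc j)"]) (auto simp: z_def increment_def)
  qed simp
  have Ti: "T i \<in> barriers \<mu> n i" if "i \<le> n" for i
    using T that by (auto simp: transversals_def)
  have T0: "T 0 = 0" and Tn: "T n = 0"
    using Ti[of 0] Ti[of n] by (auto simp: barriers_def)
  show ?thesis
  proof (cases "sqrt 2 * \<delta> < 3")
    case False
    then have "sqrt 2 * (4 * sqrt (2 - sqrt 3)) < sqrt 2 * \<delta>" using extremal_value_bounds(2) by linarith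
    then have "4 * sqrt (2 - sqrt 3) < \<delta>" by simp
    moreover have "(1 - \<mu> / 4) * (4 * sqrt (2 - sqrt 3)) \<le> 4 * sqrt (2 - sqrt 3)"
      using mu extremal_value_bounds(1) by (intro mult_left_le_one_le) auto
    ultimately show ?thesis unfolding \<delta>_def by linarith
  next
    case True
    \<comment> \<open>The four choices of signs together bound \<open>\<bar>x\<bar> + \<bar>y\<bar>\<close>.\<close>
    have reach: "\<sigma> * T t $ 1 + \<tau> * T t $ 2 < 3 * real n / 4"
      if "t \<le> n" and sg: "\<bar>\<sigma>\<bar> = 1" "\<bar>\<tau>\<bar> = 1" for t and \<sigma> \<tau> :: real
    proof -
      have "\<sigma>\<^sup>2 = 1" "\<tau>\<^sup>2 = 1" using sg by (metis power2_abs one_power2)+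
      then have *: "\<sigma> * v $ 1 + \<tau> * v $ 2 \<le> sqrt 2 * \<delta>" if "norm v \<le> \<delta>" for v :: "real ^ 2"
        using inner_le_of_norm[OF that, of \<sigma> \<tau>] by simp
      have "0 \<le> sqrt 2 * \<delta>" using diam[of 0 0] n' by simp
      then have "\<sigma> * T t $ 1 + \<tau> * T t $ 2 \<le> sqrt 2 * \<delta> * real n / 4"
        using n' T0 Tn that(1) *[OF diam]
        by (intro bridge_bound[where f = "\<lambda>i. \<sigma> * T i $ 1 + \<tau> * T i $ 2"])
          (auto simp: z_def algebra_simps)
      also have "\<dots> < 3 * real n / 4" using True n' by simp
      finally show ?thesis .
    qed
    have adm: "front (real i) (T i $ 2)" "front (real n - real i) (T i $ 1)"
        "avoids_gap \<mu> n i (T i $ 1) (T i $ 2)" if "0 < i" "i < n" for i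
    proof -
      have "\<bar>T i $ 1\<bar> + \<bar>T i $ 2\<bar> < 3 * real n / 4"
        using reach[of i 1 1] reach[of i 1 "-1"] reach[of i "-1" 1] reach[of i "-1" "-1"] that
        by simp
      with Ti[of i] that show "front (real i) (T i $ 2)" "front (real n - real i) (T i $ 1)"
        "avoids_gap \<mu> n i (T i $ 1) (T i $ 2)"
        by (auto simp: barriers_def admissible_def)
    qed
    have front_minus: "front t (- u) = front t u" for t u by (simp add: front_def)
    have vert: "\<exists>i<n. \<tau> * z i $ 2 \<le> - 1" if "\<bar>\<tau>\<bar> = 1" for \<tau> :: real
    proof -
      have "\<tau> = 1 \<or> \<tau> = - 1" using that by linarith
      then show ?thesis
        using front_crossing[of n "\<lambda>i. \<tau> * T i $ 2"] adm(1) n' T0 Tn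
        by (auto simp: front_minus z_def algebra_simps)
    qed
    \<comment> \<open>The vertical fronts \<open>\<bar>x\<bar> = n - i\<close> move inwards, so they are crossed by the time-reversed walk; the
      reversal changes the sign of the steps.\<close>
    have hor: "\<exists>i<n. \<sigma> * z i $ 1 \<le> - 1" if "\<bar>\<sigma>\<bar> = 1" for \<sigma> :: real
    proof -
      have s: "\<sigma> = 1 \<or> \<sigma> = - 1" using that by linarith
      have "front (real i) (- \<sigma> * T (n - i) $ 1)" if "0 < i" "i < n" for i
        using adm(2)[of "n - i"] that s by (auto simp: front_minus of_nat_diff)
      then obtain i where i: "i < n" "- \<sigma> * T (n - Suc i) $ 1 - - \<sigma> * T (n - i) $ 1 \<le> - 1"
        using front_crossing[of n "\<lambda>i. - \<sigma> * T (n - i) $ 1"] n' T0 Tn by auto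
      moreover have "Suc (n - Suc i) = n - i" using i(1) by simp
      ultimately have "\<sigma> * z (n - Suc i) $ 1 \<le> - 1" by (simp add: z_def algebra_simps)
      moreover have "n - Suc i < n" using i(1) by simp
      ultimately show ?thesis by blast
    qed
    obtain i where i: "i < n" "2 - \<mu> \<le> \<bar>z i $ 1\<bar> + \<bar>z i $ 2\<bar>"
      using gap_crossing[OF mu n'(2), of "\<lambda>i. T i $ 1" "\<lambda>i. T i $ 2"] adm(3) n' T0 Tn
      by (auto simp: z_def)
    define \<sigma> \<tau> :: real where "\<sigma> = (if 0 \<le> z i $ 1 then 1 else - 1)"
      and "\<tau> = (if 0 \<le> z i $ 2 then 1 else - 1)"
    have sg: "\<bar>\<sigma>\<bar> = 1" "\<bar>\<tau>\<bar> = 1" and p: "2 - \<mu> \<le> \<sigma> * z i $ 1 + \<tau> * z i $ 2"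
      using i(2) by (auto simp: \<sigma>_def \<tau>_def)
    obtain j where j: "j < n" "\<sigma> * z j $ 1 \<le> - 1" using hor[OF sg(1)] by blast
    obtain k where k: "k < n" "\<tau> * z k $ 2 \<le> - 1" using vert[OF sg(2)] by blast
    show ?thesis
      using triangle_diameter[OF sg p j(2) k(2) diam[OF i(1) j(1)] diam[OF i(1) k(1)]
          diam[OF j(1) k(1)]]
      unfolding \<delta>_def .
  qed
qed

theorem theorem1p5:
  shows "D_star TYPE(2) \<ge> ereal (4 * sqrt (2 - sqrt 3)) \<and>
    (\<forall>\<epsilon>::real. \<epsilon> > 0 \<longrightarrow>
       (\<exists>n0::nat. \<forall>n\<ge>n0. \<exists>A :: nat \<Rightarrow> (real ^ 2) set.
          grid_like n A \<and>
          (\<forall>T\<in>transversals n A. D n T > 4 * sqrt (2 - sqrt 3) - \<epsilon>)))"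
proof -
  define \<delta> where "\<delta> = 4 * sqrt (2 - sqrt (3::real))"
  have \<delta>: "\<delta> \<le> 3" using extremal_value_bounds(3) by (simp add: \<delta>_def)
  have seq: "\<exists>n0::nat. \<forall>n\<ge>n0. \<exists>A :: nat \<Rightarrow> (real ^ 2) set.
      grid_like n A \<and> (\<forall>T\<in>transversals n A. D n T > \<delta> - \<epsilon>)" if "\<epsilon> > 0" for \<epsilon> :: real
  proof -
    define \<mu> where "\<mu> = min 1 \<epsilon>"
    have mu: "0 < \<mu>" "\<mu> \<le> 1" "\<mu> \<le> \<epsilon>" using that by (auto simp: \<mu>_def)
    have "\<mu> / 4 * \<delta> < \<epsilon>"
    proof -
      have "\<mu> / 4 * \<delta> \<le> \<mu> / 4 * 3" using \<delta> mu by (intro mult_left_mono) auto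
      then show ?thesis using mu by linarith
    qed
    then have le: "\<delta> - \<epsilon> < (1 - \<mu> / 4) * \<delta>" by (simp add: algebra_simps)
    obtain n0 :: nat where n0: "24 + 56 / \<mu> \<le> real n0" using real_arch_simple by blast
    show ?thesis
    proof (intro exI[of _ n0] allI impI)
      fix n assume "n0 \<le> n"
      then have n: "24 + 56 / \<mu> \<le> real n" using n0 by linarith
      show "\<exists>A :: nat \<Rightarrow> (real ^ 2) set.
          grid_like n A \<and> (\<forall>T\<in>transversals n A. D n T > \<delta> - \<epsilon>)"
      proof (intro exI[of _ "barriers \<mu> n"] conjI ballI)
        show "grid_like n (barriers \<mu> n)" by (rule grid_like_barriers[OF mu(1,2) n])
        show "D n T > \<delta> - \<epsilon>" if "T \<in> transversals n (barriers \<mu> n)" for T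
          using diameter_of_barrier_transversal[OF mu(1,2) n that] le unfolding \<delta>_def by linarith
      qed
    qed
  qed
  have "ereal \<delta> \<le> D_star TYPE(2)"
  proof (rule ereal_le_epsilon2)
    fix e :: real assume "0 < e"
    then obtain n and A :: "nat \<Rightarrow> (real ^ 2) set"
      where A: "grid_like n A" "\<forall>T\<in>transversals n A. D n T > \<delta> - e"
      using seq by blast
    have "ereal (\<delta> - e) \<le> (INF T\<in>transversals n A. ereal (D n T))"
      using A(2) by (intro INF_greatest) (auto intro: less_imp_le)
    also have "\<dots> \<le> D_star TYPE(2)"
      unfolding D_star_def using A(1) by (intro SUP_upper2[of "(n, A)"]) auto
    finally have "ereal (\<delta> - e) + ereal e \<le> D_star TYPE(2) + ereal e"
      by (rule add_right_mono)
    then show "ereal \<delta> \<le> D_star TYPE(2) + ereal e" by simp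
  qed
  with seq show ?thesis unfolding \<delta>_def by blast
qed

end
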